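(* Let $(X,d)$ be a metric space and let $\mathcal U$ be the family of unbounded subsets of $X$. The function $s^+$ is a premetric on $\mathcal U$ satisfying a weak form of the triangle inequality, i.e. for all unbounded subsets $R,S,T$ of $X$: (1) $s^+(R,S)\in[0,1]$ and $s^+(R,R)=0$, (2) $s^+(R,T)\le s^+(R,S)+s^+(R,S)s^+(S,T)+s^+(S,T)$. Similarly, $s$ is a symmetric premetric on $\mathcal U$ satisfying the same weak triangle inequality, i.e. (3) $s(R,S)\in[0,1]$ and $s(R,R)=0$, (4) $s(R,S)=s(S,R)$, (5) $s(R,T)\le s(R,S)+s(R,S)s(S,T)+s(S,T)$. Finally, $t$ is a pseudometric on $\mathcal U$, i.e. (6) $t(R,S)\in[0,1]$ and $t(R,R)=0$, (7) $t(R,S)=t(S,R)$, (8) $t(R,T)\le t(R,S)+t(S,T)$.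
   Context: Fix a reference point $o\in X$ and let $B(x,r)=\{y\in X: d(y,x)\le r\}$. For $R\subseteq X$ and $\alpha,a\ge0$ put $\alpha R+a=\bigcup_{x\in R}B(x,\alpha d(o,x)+a)$. For $R,S\subseteq X$ let $s^+(R,S)$ be the infimum of all $\alpha\ge0$ such that $S\subseteq\alpha R+a$ for some $a\ge0$; put $s(R,S)=\max\{s^+(R,S),s^+(S,R)\}$ and $t(R,S)=\sqrt{s(R,S)}$. *)

theory Defs
  imports "HOL-Analysis.Analysis"
begin

text \<open>The reference point of the metric space is the parameter \<open>p\<close> throughout.\<close>

definition thickening :: "'a::metric_space \<Rightarrow> real \<Rightarrow> 'a set \<Rightarrow> real \<Rightarrow> 'a set" where
  "thickening p \<alpha> R a = (\<Union>x\<in>R. cball x (\<alpha> * dist p x + a))"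

text \<open>The infimum is taken in the extended reals, so that it is \<open>\<infinity>\<close> when no \<open>\<alpha>\<close> is
  admissible (which can only happen when \<open>R\<close> is bounded).\<close>

definition s_plus :: "'a::metric_space \<Rightarrow> 'a set \<Rightarrow> 'a set \<Rightarrow> ereal" where
  "s_plus p R S = Inf (ereal ` {\<alpha>. 0 \<le> \<alpha> \<and> (\<exists>a\<ge>0. S \<subseteq> thickening p \<alpha> R a)})"

definition s_dist :: "'a::metric_space \<Rightarrow> 'a set \<Rightarrow> 'a set \<Rightarrow> ereal" where
  "s_dist p R S = max (s_plus p R S) (s_plus p S R)"

text \<open>Meaningful for nonnegative arguments only.\<close>

definition ereal_sqrt :: "ereal \<Rightarrow> ereal" where
  "ereal_sqrt x = (if x = \<infinity> then \<infinity> else ereal (sqrt (real_of_ereal x)))"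

definition t_dist :: "'a::metric_space \<Rightarrow> 'a set \<Rightarrow> 'a set \<Rightarrow> ereal" where
  "t_dist p R S = ereal_sqrt (s_dist p R S)"

end

theory Submission
  imports Defs
begin

text \<open>
  Call \<open>\<alpha>\<close> admissible for \<open>(R, S)\<close> if \<open>S \<subseteq> \<alpha>R + a\<close> for some \<open>a \<ge> 0\<close>.  The admissible
  numbers form an up-closed set, so every real number above \<open>s\<^sup>+(R, S)\<close> is admissible and
  estimates for admissible numbers pass to the infimum.

  If \<open>R\<close> is unbounded, every \<open>\<alpha> > 1\<close> is admissible, even with \<open>a = 0\<close>: a point \<open>y\<close> is at
  distance at most \<open>d(o,x) + d(o,y)\<close> from \<open>x\<close>, and the surplus \<open>(\<alpha> - 1) d(o,x)\<close> absorbs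
  \<open>d(o,y)\<close> once \<open>x \<in> R\<close> is far enough away.  Hence \<open>s\<^sup>+ \<le> 1\<close>.

  If \<open>y\<close> lies in the ball of radius \<open>\<alpha> d(o,x) + a\<close> about \<open>x\<close>, then \<open>d(o,y)\<close> is at most
  \<open>(1 + \<alpha>) d(o,x) + a\<close>.  So a second jump with rate \<open>\<beta>\<close> from \<open>y\<close> has rate \<open>\<beta> (1 + \<alpha>)\<close> when
  measured from \<open>x\<close>, and the composite has rate \<open>\<alpha> + \<alpha>\<beta> + \<beta>\<close>.  This is the weak triangle
  inequality for \<open>s\<^sup>+\<close>; since its right-hand side is monotone and symmetric in the two values, it is
  inherited by the maximum \<open>s\<close>.

  Finally, \<open>uv \<le> 1\<close> gives \<open>uv \<le> \<surd>(uv)\<close>, so \<open>u + uv + v \<le> (\<surd>u + \<surd>v)\<^sup>2\<close>.  This is where the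
  bound \<open>s \<le> 1\<close> turns the weak triangle inequality into the genuine one for \<open>t = \<surd>s\<close>.
\<close>

lemma mem_thickening_iff:
  "y \<in> thickening p \<alpha> R a \<longleftrightarrow> (\<exists>x\<in>R. dist x y \<le> \<alpha> * dist p x + a)"
  by (simp add: thickening_def)

lemma thickening_mono:
  assumes "\<alpha> \<le> \<beta>"
  shows "thickening p \<alpha> R a \<subseteq> thickening p \<beta> R a"
proof
  fix y assume "y \<in> thickening p \<alpha> R a"
  then obtain x where x: "x \<in> R" "dist x y \<le> \<alpha> * dist p x + a"
    by (auto simp: mem_thickening_iff)
  have "\<alpha> * dist p x \<le> \<beta> * dist p x"
    using assms by (simp add: mult_right_mono)
  with x show "y \<in> thickening p \<beta> R a"
    by (force simp: mem_thickening_iff)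
qed

text \<open>
  The distance from \<open>p\<close> grows by a factor of at most \<open>1 + \<alpha>\<close> in the inner thickening, which is
  the source of the product term.
\<close>

lemma thickening_thickening_subset:
  assumes "0 \<le> \<beta>"
  shows "thickening p \<beta> (thickening p \<alpha> R a) b
           \<subseteq> thickening p (\<alpha> + \<alpha> * \<beta> + \<beta>) R (a + \<beta> * a + b)"
proof
  fix z assume "z \<in> thickening p \<beta> (thickening p \<alpha> R a) b"
  then obtain x y where x: "x \<in> R" and xy: "dist x y \<le> \<alpha> * dist p x + a"
    and yz: "dist y z \<le> \<beta> * dist p y + b"
    by (auto simp: mem_thickening_iff)
  have "dist p y \<le> dist p x + (\<alpha> * dist p x + a)"
    using xy dist_triangle[of p y x] by linarith
  then have "\<beta> * dist p y \<le> \<beta> * (dist p x + (\<alpha> * dist p x + a))"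
    using assms by (rule mult_left_mono)
  then have "dist x z \<le> (\<alpha> * dist p x + a) + \<beta> * (dist p x + (\<alpha> * dist p x + a)) + b"
    using xy yz dist_triangle[of x z y] by linarith
  also have "\<dots> = (\<alpha> + \<alpha> * \<beta> + \<beta>) * dist p x + (a + \<beta> * a + b)"
    by (simp add: algebra_simps)
  finally show "z \<in> thickening p (\<alpha> + \<alpha> * \<beta> + \<beta>) R (a + \<beta> * a + b)"
    using x by (auto simp: mem_thickening_iff)
qed

lemma thickening_mono_set: "R \<subseteq> S \<Longrightarrow> thickening p \<alpha> R a \<subseteq> thickening p \<alpha> S a"
  by (auto simp: thickening_def)

text \<open>
  The ball about \<open>x\<close> has a radius exceeding \<open>dist p x\<close> by an amount proportional to \<open>dist p x\<close>,
  so a point \<open>x\<close> of \<open>R\<close> far from \<open>p\<close> reaches any prescribed \<open>y\<close>.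
\<close>

lemma thickening_eq_UNIV:
  assumes "\<not> bounded R" and "1 < \<alpha>"
  shows "thickening p \<alpha> R 0 = UNIV"
proof -
  have "y \<in> thickening p \<alpha> R 0" for y
  proof -
    obtain x where x: "x \<in> R" "dist p y / (\<alpha> - 1) < dist p x"
      using assms(1) by (meson bounded_def not_less)
    then have "dist p y \<le> (\<alpha> - 1) * dist p x"
      using assms(2) by (simp add: field_simps)
    then have "dist x y \<le> \<alpha> * dist p x"
      using dist_triangle[of x y p] by (simp add: algebra_simps dist_commute)
    with x show ?thesis
      by (auto simp: mem_thickening_iff)
  qed
  then show ?thesis
    by auto
qed

lemma s_plus_nonneg: "0 \<le> s_plus p R S"
  unfolding s_plus_def by (rule Inf_greatest) auto

lemma s_plus_le:
  assumes "0 \<le> \<alpha>" "0 \<le> a" "S \<subseteq> thickening p \<alpha> R a"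
  shows "s_plus p R S \<le> ereal \<alpha>"
  unfolding s_plus_def using assms by (intro Inf_lower) auto

lemma subset_thickening_if_s_plus_less:
  assumes "s_plus p R S < ereal \<alpha>"
  shows "\<exists>a\<ge>0. S \<subseteq> thickening p \<alpha> R a"
proof -
  obtain \<beta> a where "\<beta> < \<alpha>" "0 \<le> a" "S \<subseteq> thickening p \<beta> R a"
    using assms by (auto simp: s_plus_def Inf_less_iff)
  then show ?thesis
    using thickening_mono[of \<beta> \<alpha> p R a] by auto
qed

lemma s_plus_self: "s_plus p R R = 0"
proof -
  have "R \<subseteq> thickening p 0 R 0"
    by (force simp: mem_thickening_iff)
  then have "s_plus p R R \<le> ereal 0"
    by (intro s_plus_le) auto
  then show ?thesis
    using s_plus_nonneg[of p R R] by (simp add: zero_ereal_def)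
qed

lemma s_plus_le_one:
  assumes "\<not> bounded R"
  shows "s_plus p R S \<le> 1"
proof -
  have "s_plus p R S \<le> 1 + ereal e" if "0 < e" for e
    using s_plus_le[of "1 + e" 0 S p R] thickening_eq_UNIV[OF assms, of "1 + e" p] that
    by (simp add: one_ereal_def)
  then show ?thesis
    by (rule ereal_le_epsilon2)
qed

text \<open>
  The infima need not be attained, so thickenings are composed at \<open>u + e\<close> and \<open>v + e\<close>, and \<open>e\<close>
  tends to 0 afterwards.  Finiteness provides such admissible numbers; it holds in particular
  for unbounded sets.
\<close>

lemma s_plus_triangle:
  assumes "s_plus p R S \<noteq> \<infinity>" "s_plus p S T \<noteq> \<infinity>"
  shows "s_plus p R T \<le> s_plus p R S + s_plus p R S * s_plus p S T + s_plus p S T"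
proof -
  obtain u where u: "s_plus p R S = ereal u" "0 \<le> u"
    using assms(1) s_plus_nonneg[of p R S] by (cases "s_plus p R S") auto
  obtain v where v: "s_plus p S T = ereal v" "0 \<le> v"
    using assms(2) s_plus_nonneg[of p S T] by (cases "s_plus p S T") auto
  let ?bound = "\<lambda>e. (u + e) + (u + e) * (v + e) + (v + e)"
  have le: "s_plus p R T \<le> ereal (?bound e)" if e: "0 < e" for e
  proof -
    obtain a where a: "0 \<le> a" "S \<subseteq> thickening p (u + e) R a"
      using subset_thickening_if_s_plus_less[of p R S "u + e"] u e by auto
    obtain b where b: "0 \<le> b" "T \<subseteq> thickening p (v + e) S b"
      using subset_thickening_if_s_plus_less[of p S T "v + e"] v e by auto
    have "T \<subseteq> thickening p (v + e) (thickening p (u + e) R a) b"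
      using b(2) thickening_mono_set[OF a(2)] by blast
    then have "T \<subseteq> thickening p (?bound e) R (a + (v + e) * a + b)"
      using thickening_thickening_subset[of "v + e"] v(2) e by fastforce
    then show ?thesis
      using u(2) v(2) a(1) b(1) e by (intro s_plus_le) auto
  qed
  have "(?bound \<longlongrightarrow> ?bound 0) (at_right 0)"
    by (intro tendsto_intros)
  then have "((\<lambda>e. ereal (?bound e)) \<longlongrightarrow> ereal (?bound 0)) (at_right 0)"
    by (rule tendsto_ereal)
  moreover have "eventually (\<lambda>e. s_plus p R T \<le> ereal (?bound e)) (at_right 0)"
    using eventually_at_right_less by (rule eventually_mono) (rule le)
  ultimately have "s_plus p R T \<le> ereal (?bound 0)"
    by (rule tendsto_lowerbound) simp
  then show ?thesis
    using u v by simp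
qed

lemma s_dist_nonneg: "0 \<le> s_dist p R S"
  by (simp add: s_dist_def s_plus_nonneg le_max_iff_disj)

lemma s_dist_self: "s_dist p R R = 0"
  by (simp add: s_dist_def s_plus_self)

lemma s_dist_commute: "s_dist p R S = s_dist p S R"
  by (simp add: s_dist_def max.commute)

lemma s_dist_le_one:
  assumes "\<not> bounded R" "\<not> bounded S"
  shows "s_dist p R S \<le> 1"
  using assms by (simp add: s_dist_def s_plus_le_one)

lemma s_dist_triangle:
  assumes "s_dist p R S \<noteq> \<infinity>" "s_dist p S T \<noteq> \<infinity>"
  shows "s_dist p R T \<le> s_dist p R S + s_dist p R S * s_dist p S T + s_dist p S T"
proof -
  have half: "s_plus p A C \<le> s_dist p A B + s_dist p A B * s_dist p B C + s_dist p B C"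
    if "s_dist p A B \<noteq> \<infinity>" "s_dist p B C \<noteq> \<infinity>" for A B C
  proof -
    have le: "s_plus p A B \<le> s_dist p A B" "s_plus p B C \<le> s_dist p B C"
      by (auto simp: s_dist_def)
    have "s_plus p A C \<le> s_plus p A B + s_plus p A B * s_plus p B C + s_plus p B C"
      using le that by (intro s_plus_triangle) auto
    also have "\<dots> \<le> s_dist p A B + s_dist p A B * s_dist p B C + s_dist p B C"
      using le by (intro add_mono ereal_mult_mono s_plus_nonneg s_dist_nonneg) auto
    finally show ?thesis .
  qed
  have "s_plus p T R \<le> s_dist p R S + s_dist p R S * s_dist p S T + s_dist p S T"
    using half[of T S R] assms by (simp add: s_dist_commute ac_simps)
  with half[OF assms] show ?thesis
    by (simp add: s_dist_def[of p R T])
qed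

text \<open>
  The hypothesis \<open>u * v \<le> 1\<close> lets the product be absorbed by the cross term
  \<open>2 * sqrt u * sqrt v\<close> of the square.
\<close>

lemma sqrt_le_add_sqrt:
  fixes u v w :: real
  assumes "0 \<le> u" "0 \<le> v" "u * v \<le> 1" "w \<le> u + u * v + v"
  shows "sqrt w \<le> sqrt u + sqrt v"
proof (rule real_le_lsqrt)
  show "0 \<le> sqrt u + sqrt v"
    using assms by simp
  have q: "0 \<le> sqrt (u * v)" "sqrt (u * v) \<le> 1"
    using assms by auto
  have "u * v = sqrt (u * v) * sqrt (u * v)"
    using assms by simp
  also have "\<dots> \<le> sqrt (u * v)"
    using q(2,1) by (rule mult_left_le)
  finally have "u * v \<le> 2 * sqrt (u * v)"
    using q by linarith
  then show "w \<le> (sqrt u + sqrt v)\<^sup>2"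
    using assms by (simp add: power2_sum real_sqrt_mult)
qed

lemma t_dist_eq_sqrt:
  assumes "s_dist p R S = ereal u"
  shows "t_dist p R S = ereal (sqrt u)"
  by (simp add: t_dist_def ereal_sqrt_def assms)

lemma s_dist_real:
  assumes "\<not> bounded R" "\<not> bounded S"
  obtains u where "s_dist p R S = ereal u" "0 \<le> u" "u \<le> 1"
  using s_dist_nonneg[of p R S] s_dist_le_one[OF assms, of p]
  by (cases "s_dist p R S") (auto simp: one_ereal_def)

lemma t_dist_mem:
  assumes "\<not> bounded R" "\<not> bounded S"
  shows "t_dist p R S \<in> {0..1}"
proof -
  obtain u where "s_dist p R S = ereal u" "0 \<le> u" "u \<le> 1"
    using s_dist_real[OF assms] .
  then show ?thesis
    by (simp add: t_dist_eq_sqrt)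
qed

lemma t_dist_self: "t_dist p R R = 0"
  using t_dist_eq_sqrt[of p R R 0] by (simp add: s_dist_self)

lemma t_dist_commute: "t_dist p R S = t_dist p S R"
  by (simp add: t_dist_def s_dist_commute)

lemma t_dist_triangle:
  assumes "\<not> bounded R" "\<not> bounded S" "\<not> bounded T"
  shows "t_dist p R T \<le> t_dist p R S + t_dist p S T"
proof -
  obtain u where u: "s_dist p R S = ereal u" "0 \<le> u" "u \<le> 1"
    using s_dist_real[OF assms(1,2)] .
  obtain v where v: "s_dist p S T = ereal v" "0 \<le> v" "v \<le> 1"
    using s_dist_real[OF assms(2,3)] .
  obtain w where w: "s_dist p R T = ereal w"
    using s_dist_real[OF assms(1,3)] .
  have "w \<le> u + u * v + v"
    using s_dist_triangle[of p R S T] u v w by simp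
  then have "sqrt w \<le> sqrt u + sqrt v"
    using u v by (intro sqrt_le_add_sqrt mult_le_one) auto
  then show ?thesis
    using u v w by (simp add: t_dist_eq_sqrt)
qed

theorem proposition2p6:
  fixes p :: "'a::metric_space" and R S T :: "'a set"
  assumes "\<not> bounded R" and "\<not> bounded S" and "\<not> bounded T"
  shows "(s_plus p R S \<in> {0..1} \<and> s_plus p R R = 0)
    \<and> s_plus p R T \<le> s_plus p R S + s_plus p R S * s_plus p S T + s_plus p S T
    \<and> (s_dist p R S \<in> {0..1} \<and> s_dist p R R = 0)
    \<and> s_dist p R S = s_dist p S R
    \<and> s_dist p R T \<le> s_dist p R S + s_dist p R S * s_dist p S T + s_dist p S T
    \<and> (t_dist p R S \<in> {0..1} \<and> t_dist p R R = 0)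
    \<and> t_dist p R S = t_dist p S R
    \<and> t_dist p R T \<le> t_dist p R S + t_dist p S T"
proof -
  have plus: "s_plus p R S \<noteq> \<infinity>" "s_plus p S T \<noteq> \<infinity>"
    and dist: "s_dist p R S \<noteq> \<infinity>" "s_dist p S T \<noteq> \<infinity>"
    using s_plus_le_one[OF assms(1), of p S] s_plus_le_one[OF assms(2), of p T]
      s_dist_le_one[OF assms(1,2), of p] s_dist_le_one[OF assms(2,3), of p] by auto
  show ?thesis
    using s_plus_triangle[OF plus] s_dist_triangle[OF dist]
      t_dist_mem[OF assms(1,2)] t_dist_triangle[OF assms] s_dist_commute t_dist_commute
    by (auto simp: s_plus_nonneg s_plus_le_one s_plus_self s_dist_nonneg s_dist_le_one
        s_dist_self t_dist_self assms)
qed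

end
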